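(* Let $H$ be a complex Hilbert space and let $A,B\in B(H)$ be such that $AB=BA$. If $A$ is normal, then $|AB|=|A||B|$.
   Context: $B(H)$ denotes the algebra of bounded linear operators on $H$. For $T\in B(H)$, $|T|=\sqrt{T^*T}$ denotes the absolute value (modulus) of $T$, i.e. the unique positive square root of $T^*T$. An operator $T$ is normal if $TT^*=T^*T$. *)

theory Defs
  imports "HOL-Analysis.Analysis"
begin

text \<open>
  A complex inner product space is presented on top of its underlying real inner product space,
  whose inner product is the real part of the complex one. In particular the norm, the topology and
  the notion of boundedness are those induced by the complex inner product.
  The complex inner product is linear in its first argument and conjugate linear in its second.
\<close>

class complex_inner = real_inner +
  fixes scaleC :: "complex \<Rightarrow> 'a \<Rightarrow> 'a" (infixr "*\<^sub>C" 75)
    and cinner :: "'a \<Rightarrow> 'a \<Rightarrow> complex"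
  assumes scaleC_add_right: "a *\<^sub>C (x + y) = a *\<^sub>C x + a *\<^sub>C y"
    and scaleC_add_left: "(a + b) *\<^sub>C x = a *\<^sub>C x + b *\<^sub>C x"
    and scaleC_scaleC: "a *\<^sub>C b *\<^sub>C x = (a * b) *\<^sub>C x"
    and scaleC_of_real: "complex_of_real r *\<^sub>C x = r *\<^sub>R x"
    and cinner_add_left: "cinner (x + y) z = cinner x z + cinner y z"
    and cinner_scaleC_left: "cinner (a *\<^sub>C x) y = a * cinner x y"
    and cinner_commute: "cinner x y = cnj (cinner y x)"
    and Re_cinner: "Re (cinner x y) = inner x y"

class chilbert_space = complex_inner + complete_space

instantiation complex :: chilbert_space
begin

definition scaleC_complex :: "complex \<Rightarrow> complex \<Rightarrow> complex"
  where "scaleC_complex a x = a * x"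

definition cinner_complex :: "complex \<Rightarrow> complex \<Rightarrow> complex"
  where "cinner_complex x y = x * cnj y"

instance
  by standard
    (simp_all add: scaleC_complex_def cinner_complex_def algebra_simps scaleR_conv_of_real
      inner_complex_def)

end

definition bounded_clinear :: "('a::complex_inner \<Rightarrow> 'a) \<Rightarrow> bool"
  where "bounded_clinear T \<longleftrightarrow> bounded_linear T \<and> (\<forall>a x. T (a *\<^sub>C x) = a *\<^sub>C T x)"

definition cadjoint :: "('a::chilbert_space \<Rightarrow> 'a) \<Rightarrow> 'a \<Rightarrow> 'a"
  where "cadjoint T =
    (THE S. bounded_clinear S \<and> (\<forall>x y. cinner (T x) y = cinner x (S y)))"

definition normal_op :: "('a::chilbert_space \<Rightarrow> 'a) \<Rightarrow> bool"
  where "normal_op T \<longleftrightarrow> T \<circ> cadjoint T = cadjoint T \<circ> T"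

definition positive_op :: "('a::chilbert_space \<Rightarrow> 'a) \<Rightarrow> bool"
  where "positive_op T \<longleftrightarrow>
    bounded_clinear T \<and> (\<forall>x. cinner (T x) x \<in> \<real> \<and> 0 \<le> Re (cinner (T x) x))"

definition sqrt_op :: "('a::chilbert_space \<Rightarrow> 'a) \<Rightarrow> 'a \<Rightarrow> 'a"
  where "sqrt_op T = (THE P. positive_op P \<and> P \<circ> P = T)"

definition abs_op :: "('a::chilbert_space \<Rightarrow> 'a) \<Rightarrow> 'a \<Rightarrow> 'a"
  where "abs_op T = sqrt_op (cadjoint T \<circ> T)"

end

theory Submission
  imports Defs "HOL-Complex_Analysis.Cauchy_Integral_Formula"
    "HOL-Computational_Algebra.Formal_Power_Series"
begin

text \<open>
  Write \<open>A*\<close> for the adjoint of \<open>A\<close>. Fuglede's theorem turns \<open>AB = BA\<close> into \<open>A*B = BA*\<close>, and taking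
  adjoints gives \<open>AB* = B*A\<close>. Hence \<open>A*A\<close> commutes with \<open>B\<close> and with \<open>B*\<close>. A positive square root
  commutes with everything that commutes with the operator under the root, so \<open>|A|\<close> commutes with
  \<open>B\<close> and \<open>B*\<close>, therefore with \<open>B*B\<close>, and therefore with \<open>|B|\<close>. The product \<open>|A||B|\<close> of commuting
  positive operators is positive, and its square is \<open>A*A B*B = (AB)*(AB)\<close>. As positive square roots
  are unique, \<open>|A||B| = |AB|\<close>.

  The adjoint comes from the Riesz representation theorem (\<open>riesz_representation\<close>), applied to the
  underlying real Hilbert space: the complex inner product is determined by its real part, and the
  real adjoint of a complex linear operator is again complex linear.

  The square root comes from the binomial series of \<open>\<surd>(1 - t)\<close>, whose coefficients are absolutely
  summable. It therefore converges at every contraction \<open>A\<close> and yields a square root of \<open>1 - A\<close>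
  (\<open>sqrt_series_square\<close>). For a positive operator \<open>T\<close> with bound \<open>K\<close>, the operator \<open>1 - T/K\<close> is a
  contraction (\<open>positive_op_contraction\<close>). Being a limit of polynomials in \<open>T\<close>, the resulting root
  commutes with all bounded operators that commute with \<open>T\<close>; uniqueness follows from this.

  Fuglede's theorem (\<open>fuglede\<close>) is proved by Cauchy's estimate in place of exponentials and Liouville's
  theorem. Put \<open>M\<^sub>\<mu> = 1 + \<mu>A*\<close>. Its adjoint \<open>N = 1 + cnj \<mu> A\<close> is normal and commutes with \<open>B\<close>, so that
  \<open>\<parallel>M\<^sub>\<mu>\<^sup>n B x\<parallel> = \<parallel>N\<^sup>n B x\<parallel> = \<parallel>B N\<^sup>n x\<parallel> \<le> \<parallel>B\<parallel> \<parallel>N\<^sup>n x\<parallel> = \<parallel>B\<parallel> \<parallel>M\<^sub>\<mu>\<^sup>n x\<parallel>\<close>.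
  Take \<open>\<mu> = \<lambda>/n\<close> and \<open>x = (1 - \<mu>A*)\<^sup>n y\<close>. Then \<open>(1 + \<lambda>A*/n)\<^sup>n B (1 - \<lambda>A*/n)\<^sup>n y\<close> is a polynomial in \<open>\<lambda>\<close>
  with linear coefficient \<open>(A*B - BA*) y\<close>, and its norm is at most
  \<open>\<parallel>B\<parallel> (1 + |\<lambda>|\<^sup>2\<parallel>A*\<parallel>\<^sup>2/n\<^sup>2)\<^sup>n \<parallel>y\<parallel>\<close>. On the circle \<open>|\<lambda>| = m\<close> with \<open>n = m\<^sup>2\<close> this bound does not depend on
  \<open>m\<close>, so by Cauchy's estimate the linear coefficient is \<open>O(1/m)\<close> for every \<open>m\<close>, that is, zero.
\<close>

section \<open>Complex inner products and adjoints\<close>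

subclass (in chilbert_space) banach ..

lemma Im_cinner: "Im (cinner x y) = - inner (\<i> *\<^sub>C x) y"
  by (simp flip: Re_cinner add: cinner_scaleC_left)

lemma cinner_add_right: "cinner x (y + z) = cinner x y + cinner x z"
  by (metis cinner_add_left cinner_commute complex_cnj_add)

lemma cinner_scaleC_right: "cinner x (a *\<^sub>C y) = cnj a * cinner x y"
  by (metis cinner_commute cinner_scaleC_left complex_cnj_mult)

lemma cinner_zero_left [simp]: "cinner 0 z = 0"
  by (metis add_cancel_right_right cinner_add_left)

lemma cinner_self: "cinner x x = complex_of_real ((norm x)\<^sup>2)"
proof -
  have "Im (cinner x x) = 0"
    using arg_cong[OF cinner_commute[of x x], of Im] by simp
  then show ?thesis
    by (simp add: complex_eq_iff Re_cinner dot_square_norm)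
qed

lemma inner_ii_left: "inner (\<i> *\<^sub>C x) y = - inner x (\<i> *\<^sub>C y)"
  by (simp flip: Re_cinner add: cinner_scaleC_left cinner_scaleC_right)

lemma norm_scaleC: "norm (a *\<^sub>C x) = cmod a * norm (x::'a::complex_inner)"
proof -
  have "complex_of_real ((norm (a *\<^sub>C x))\<^sup>2) = a * cnj a * cinner x x"
    by (simp only: cinner_self[symmetric] cinner_scaleC_left cinner_scaleC_right mult_ac)
  also have "\<dots> = of_real ((cmod a * norm x)\<^sup>2)"
    by (simp add: cinner_self power_mult_distrib flip: complex_norm_square)
  finally show ?thesis
    by (simp only: of_real_eq_iff) (simp add: power2_eq_iff_nonneg)
qed

lemma scaleR_scaleC: "r *\<^sub>R x = complex_of_real r *\<^sub>C (x::'a::complex_inner)"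
  by (simp add: scaleC_of_real)

lemma scaleC_zero_left [simp]: "0 *\<^sub>C x = (0::'a::complex_inner)"
  using scaleC_of_real[of 0 x] by simp

lemma scaleC_one [simp]: "1 *\<^sub>C x = (x::'a::complex_inner)"
  using scaleC_of_real[of 1 x] by simp

lemma scaleC_minus_left: "(- a) *\<^sub>C x = - (a *\<^sub>C (x::'a::complex_inner))"
  by (metis add.right_inverse add_eq_0_iff scaleC_add_left scaleC_zero_left)

lemma bounded_linear_scaleC: "bounded_linear (\<lambda>x::'a::complex_inner. a *\<^sub>C x)"
  by (rule bounded_linear_intro[where K = "cmod a"])
     (simp_all add: scaleC_add_right scaleR_scaleC scaleC_scaleC norm_scaleC mult.commute)

lemma scaleC_zero_right [simp]: "a *\<^sub>C (0::'a::complex_inner) = 0"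
  by (rule linear_0[OF bounded_linear.linear[OF bounded_linear_scaleC]])

lemma scaleC_diff_right: "a *\<^sub>C (x - y) = a *\<^sub>C x - a *\<^sub>C (y::'a::complex_inner)"
  by (rule linear_diff[OF bounded_linear.linear[OF bounded_linear_scaleC]])

text \<open>
  Rotating \<open>x\<close> by a unimodular factor makes the complex inner product real, which reduces the claim
  to the real Cauchy--Schwarz inequality.
\<close>

lemma cinner_Cauchy_Schwarz:
  fixes x y :: "'a::complex_inner"
  shows "cmod (cinner x y) \<le> norm x * norm y"
proof -
  define c where "c = cinner x y"
  define u where "u = cnj c / of_real (cmod c)"
  have "c * cnj c = of_real (cmod c) * of_real (cmod c)"
    by (simp add: complex_norm_square[symmetric] power2_eq_square)
  then have "u * c = of_real (cmod c)"
    by (cases "c = 0") (simp_all add: u_def mult.commute[of "cnj c" c])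
  then have "Re (cinner (u *\<^sub>C x) y) = cmod c"
    by (simp add: cinner_scaleC_left flip: c_def)
  then have "cmod c = inner (u *\<^sub>C x) y"
    by (simp add: Re_cinner)
  also have "\<dots> \<le> norm (u *\<^sub>C x) * norm y"
    by (rule norm_cauchy_schwarz)
  also have "\<dots> \<le> norm x * norm y"
    by (intro mult_right_mono) (cases "c = 0"; simp add: norm_scaleC u_def norm_divide)+
  finally show ?thesis
    by (simp add: c_def)
qed

lemma bounded_clinearD:
  assumes "bounded_clinear T"
  shows "bounded_linear T" "T (a *\<^sub>C x) = a *\<^sub>C T x"
  using assms by (auto simp: bounded_clinear_def)

lemma bounded_clinear_linear:
  assumes "bounded_clinear T"
  shows "linear T"
  using assms bounded_linear.linear by (auto simp: bounded_clinear_def)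

lemma bounded_clinear_comp:
  assumes "bounded_clinear S" "bounded_clinear T"
  shows "bounded_clinear (S \<circ> T)"
  using assms by (auto simp: bounded_clinear_def o_def intro: bounded_linear_compose)

lemma bounded_clinear_bound:
  assumes "bounded_clinear T"
  obtains K where "K > 0" "\<And>x. norm (T x) \<le> K * norm x"
  using bounded_linear.pos_bounded[OF bounded_clinearD(1)[OF assms]] by (metis mult.commute)

text \<open>
  For complex linear \<open>T\<close> the imaginary part of an inner product is the real part at a vector
  multiplied by \<open>\<i>\<close>, so adjointness needs checking for the real inner product only.
\<close>

lemma adjoint_from_inner:
  assumes T: "bounded_clinear T" and S: "bounded_clinear S"
    and adj: "\<And>x y. inner (T x) y = inner x (S y)"
  shows "cinner (T x) y = cinner x (S y)"
  by (rule complex_eqI) (simp_all add: Re_cinner Im_cinner adj flip: bounded_clinearD(2)[OF T])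

text \<open>
  The representing vector is the minimiser of \<open>\<phi> x = \<parallel>x\<parallel>\<^sup>2 - 2 f x\<close>. By the parallelogram law every
  minimising sequence is a Cauchy sequence, and the first variation of \<open>\<phi>\<close> at its limit \<open>u\<close> is
  \<open>2 (u \<bullet> x - f x)\<close>.
\<close>

lemma riesz_representation:
  fixes f :: "'a::{real_inner,complete_space} \<Rightarrow> real"
  assumes "bounded_linear f"
  shows "\<exists>u. \<forall>x. f x = inner u x"
proof -
  interpret f: bounded_linear f by fact
  obtain K where K: "K \<ge> 0" "\<And>x. norm (f x) \<le> norm x * K"
    using f.nonneg_bounded by blast
  define \<phi> where "\<phi> x = (norm x)\<^sup>2 - 2 * f x" for x
  have lower: "- (K\<^sup>2) \<le> \<phi> x" for x
  proof -
    have "0 \<le> (norm x - K)\<^sup>2" by simp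
    then show ?thesis
      using K(2)[of x] by (simp add: \<phi>_def power2_eq_square algebra_simps)
  qed
  define m where "m = Inf (range \<phi>)"
  have bdd: "bdd_below (range \<phi>)"
    using lower by (rule bdd_belowI2)
  have m_le: "m \<le> \<phi> x" for x
    unfolding m_def using bdd by (rule cInf_lower[rotated]) simp
  have "\<exists>x. \<phi> x < m + 1 / real (Suc n)" for n
    using cInf_lessD[of "range \<phi>" "m + 1 / real (Suc n)"] by (auto simp: m_def)
  then obtain X where X: "\<And>n. \<phi> (X n) < m + 1 / real (Suc n)"
    by metis
  have para: "(norm (x - y))\<^sup>2 \<le> 2 * (\<phi> x - m) + 2 * (\<phi> y - m)" for x y
  proof -
    have "(norm (x - y))\<^sup>2 + 4 * \<phi> ((1/2) *\<^sub>R (x + y)) = 2 * \<phi> x + 2 * \<phi> y"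
      by (simp add: \<phi>_def power2_norm_eq_inner f.scaleR f.add inner_add inner_diff inner_commute
           field_simps)
    then show ?thesis using m_le[of "(1/2) *\<^sub>R (x + y)"] by simp
  qed
  have "Cauchy X"
  proof (rule metric_CauchyI)
    fix e :: real assume e: "0 < e"
    then obtain M where M: "1 / real (Suc M) < e\<^sup>2 / 4"
      using reals_Archimedean[of "e\<^sup>2 / 4"] by (auto simp: inverse_eq_divide)
    have small: "4 * (\<phi> (X n) - m) < e\<^sup>2" if "n \<ge> M" for n
    proof -
      have "1 / real (Suc n) \<le> 1 / real (Suc M)"
        using that by (simp add: field_simps)
      with X[of n] M have "\<phi> (X n) < m + e\<^sup>2 / 4"
        by (meson add_le_cancel_left le_less_trans less_le_trans less_imp_le add_less_cancel_left)
      then show ?thesis by simp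
    qed
    have "dist (X i) (X j) < e" if "i \<ge> M" "j \<ge> M" for i j
    proof -
      have "(norm (X i - X j))\<^sup>2 < e\<^sup>2"
        using para[of "X i" "X j"] small[OF that(1)] small[OF that(2)] by linarith
      then show ?thesis
        using e by (simp add: dist_norm power2_less_imp_less)
    qed
    then show "\<exists>M. \<forall>i\<ge>M. \<forall>j\<ge>M. dist (X i) (X j) < e" by blast
  qed
  then obtain u where u: "X \<longlonglongrightarrow> u"
    using Cauchy_convergent convergent_def by blast
  have "(\<lambda>n. \<phi> (X n)) \<longlonglongrightarrow> \<phi> u"
    unfolding \<phi>_def by (intro tendsto_intros f.tendsto u)
  moreover have "(\<lambda>n. m + 1 / real (Suc n)) \<longlonglongrightarrow> m + 0"
    by (intro tendsto_intros LIMSEQ_inverse_real_of_nat[unfolded inverse_eq_divide])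
  ultimately have "\<phi> u \<le> m"
    using X by (auto intro!: LIMSEQ_le simp: less_imp_le)
  then have min: "\<phi> u \<le> \<phi> y" for y
    using m_le[of y] by linarith
  have "f x = inner u x" for x
  proof -
    define d where "d = inner u x - f x"
    define s where "s = (norm x)\<^sup>2 + 1"
    have s: "s > 0" by (simp add: s_def add_nonneg_pos)
    have expand: "\<phi> (u + (- t) *\<^sub>R x) - \<phi> u = t\<^sup>2 * (norm x)\<^sup>2 - 2 * t * d" for t
      by (simp only: \<phi>_def power2_norm_eq_inner f.scaleR f.add inner_add inner_scaleR_left
          inner_scaleR_right d_def)
         (simp add: inner_commute power2_eq_square algebra_simps)
    \<comment> \<open>The step \<open>- d / s\<close> would minimise \<open>\<phi>\<close> along \<open>x\<close> if \<open>s\<close> were \<open>\<parallel>x\<parallel>\<^sup>2\<close>;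
      adding 1 avoids a division by zero.\<close>
    have "0 \<le> \<phi> (u + (- (d / s)) *\<^sub>R x) - \<phi> u"
      using min by simp
    also have "\<dots> = (d / s)\<^sup>2 * (norm x)\<^sup>2 - 2 * (d / s) * d"
      by (rule expand)
    also have "\<dots> \<le> (d / s)\<^sup>2 * s - 2 * (d / s) * d"
      by (simp add: s_def algebra_simps)
    also have "\<dots> = - (d\<^sup>2 / s)"
      using s by (simp add: power2_eq_square field_simps)
    finally have "d\<^sup>2 \<le> 0"
      using s by (simp add: zero_le_divide_iff field_simps)
    then show ?thesis by (simp add: d_def)
  qed
  then show ?thesis by blast
qed

text \<open>
  Multiplication by \<open>\<i>\<close> is skew-adjoint for the real inner product, so the real adjoint of a complex
  linear operator commutes with it and is complex linear.
\<close>

lemma adjoint_exists: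
  fixes T :: "'a::chilbert_space \<Rightarrow> 'a"
  assumes T: "bounded_clinear T"
  shows "\<exists>S. bounded_clinear S \<and> (\<forall>x y. cinner (T x) y = cinner x (S y))"
proof -
  obtain K where K: "K > 0" "\<And>x. norm (T x) \<le> K * norm x"
    using bounded_clinear_bound[OF T] by blast
  have "\<exists>u. \<forall>x. inner (T x) y = inner u x" for y
    by (rule riesz_representation)
       (rule bounded_linear_compose[OF bounded_linear_inner_left bounded_clinearD(1)[OF T]])
  then obtain S where S': "\<And>x y. inner (T x) y = inner (S y) x"
    by metis
  then have S: "inner (T x) y = inner x (S y)" for x y
    by (simp add: inner_commute)
  have eqI: "u = v" if "\<And>x. inner x u = inner x v" for u v :: 'a
    using that vector_eq_rdot[of u v] by (auto simp: inner_commute)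
  have add: "S (x + y) = S x + S y" for x y
    by (rule eqI) (simp add: inner_add_right flip: S)
  have scaleR: "S (r *\<^sub>R x) = r *\<^sub>R S x" for r x
    by (rule eqI) (simp flip: S)
  have ii: "S (\<i> *\<^sub>C y) = \<i> *\<^sub>C S y" for y
  proof (rule eqI)
    fix x
    have "inner x (S (\<i> *\<^sub>C y)) = - inner (T (\<i> *\<^sub>C x)) y"
      by (simp add: bounded_clinearD(2)[OF T] inner_ii_left flip: S)
    then show "inner x (S (\<i> *\<^sub>C y)) = inner x (\<i> *\<^sub>C S y)"
      by (simp add: S inner_ii_left)
  qed
  have decomp: "a *\<^sub>C x = Re a *\<^sub>R x + Im a *\<^sub>R (\<i> *\<^sub>C x)" for a and x :: 'a
    by (simp add: scaleR_scaleC scaleC_scaleC mult.commute complex_eq[of a, symmetric]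
        flip: scaleC_add_left)
  have "bounded_linear S"
  proof (rule bounded_linear_intro[where K = K])
    fix y
    have "norm (S y) * norm (S y) = inner (T (S y)) y"
      by (simp add: S dot_square_norm power2_eq_square)
    also have "\<dots> \<le> norm (T (S y)) * norm y"
      by (rule norm_cauchy_schwarz)
    also have "\<dots> \<le> norm (S y) * (norm y * K)"
      using mult_right_mono[OF K(2)[of "S y"] norm_ge_zero[of y]] by (simp add: mult_ac)
    finally show "norm (S y) \<le> norm y * K"
      using K(1) by (cases "S y = 0") auto
  qed (auto simp: add scaleR)
  moreover have "S (a *\<^sub>C x) = a *\<^sub>C S x" for a x
    by (simp add: decomp[of a] add scaleR ii)
  ultimately have "bounded_clinear S"
    by (simp add: bounded_clinear_def)
  with adjoint_from_inner[OF T this S] show ?thesis by blast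
qed

lemma adjoint_unique:
  assumes "\<And>x y. cinner (T x) y = cinner x (S y)" "\<And>x y. cinner (T x) y = cinner x (S' y)"
  shows "S = S'"
proof
  fix y
  have "inner x (S y) = inner x (S' y)" for x
    using assms(1)[of x y] assms(2)[of x y] by (simp flip: Re_cinner)
  then show "S y = S' y"
    using vector_eq_rdot[of "S y" "S' y"] by (auto simp: inner_commute)
qed

lemma cadjoint:
  fixes T :: "'a::chilbert_space \<Rightarrow> 'a"
  assumes "bounded_clinear T"
  shows bounded_clinear_cadjoint: "bounded_clinear (cadjoint T)"
    and cinner_cadjoint: "cinner (T x) y = cinner x (cadjoint T y)"
proof -
  have "\<exists>!S. bounded_clinear S \<and> (\<forall>x y. cinner (T x) y = cinner x (S y))"
  proof (rule ex_ex1I)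
    show "\<exists>S. bounded_clinear S \<and> (\<forall>x y. cinner (T x) y = cinner x (S y))"
      by (rule adjoint_exists[OF assms])
  qed (rule adjoint_unique[of T], simp_all)
  from theI'[OF this, folded cadjoint_def]
  show "bounded_clinear (cadjoint T)" "cinner (T x) y = cinner x (cadjoint T y)"
    by blast+
qed

lemma cadjoint_eqI:
  fixes T :: "'a::chilbert_space \<Rightarrow> 'a"
  assumes "bounded_clinear T" "\<And>x y. cinner (T x) y = cinner x (S y)"
  shows "cadjoint T = S"
  by (rule adjoint_unique[OF cinner_cadjoint[OF assms(1)] assms(2)])

lemma cadjoint_comp:
  fixes S T :: "'a::chilbert_space \<Rightarrow> 'a"
  assumes "bounded_clinear S" "bounded_clinear T"
  shows "cadjoint (S \<circ> T) = cadjoint T \<circ> cadjoint S"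
  using assms by (intro cadjoint_eqI bounded_clinear_comp) (simp_all add: cinner_cadjoint)

lemma cadjoint_cadjoint:
  fixes T :: "'a::chilbert_space \<Rightarrow> 'a"
  assumes "bounded_clinear T"
  shows "cadjoint (cadjoint T) = T"
proof (rule cadjoint_eqI[OF bounded_clinear_cadjoint[OF assms]])
  show "cinner (cadjoint T x) y = cinner x (T y)" for x y
    by (metis cinner_cadjoint[OF assms] cinner_commute)
qed

section \<open>The binomial square root series of a contraction\<close>

lemma funpow_commute_apply:
  assumes "\<And>x. f (g x) = g (f x)"
  shows "f ((g ^^ n) x) = (g ^^ n) (f x)"
  by (induction n) (simp_all add: assms)

lemma funpow_mult_commute:
  assumes "\<And>x. f (g x) = g (f x)"
  shows "(f ^^ n) ((g ^^ n) x) = ((\<lambda>x. f (g x)) ^^ n) x"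
proof (induction n)
  case (Suc n)
  have "(f ^^ Suc n) ((g ^^ Suc n) x) = f ((f ^^ n) (g ((g ^^ n) x)))"
    by simp
  also have "(f ^^ n) (g ((g ^^ n) x)) = g ((f ^^ n) ((g ^^ n) x))"
    by (rule funpow_commute_apply[symmetric]) (rule assms[symmetric])
  finally show ?case
    by (simp add: Suc)
qed simp

lemma norm_funpow_le:
  fixes f :: "'a::real_normed_vector \<Rightarrow> 'a"
  assumes "c \<ge> 0" "\<And>x. norm (f x) \<le> c * norm x"
  shows "norm ((f ^^ n) x) \<le> c ^ n * norm x"
proof (induction n)
  case (Suc n)
  have "norm ((f ^^ Suc n) x) \<le> c * norm ((f ^^ n) x)"
    using assms(2)[of "(f ^^ n) x"] by simp
  also have "\<dots> \<le> c * (c ^ n * norm x)"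
    using Suc assms(1) by (rule mult_left_mono)
  finally show ?case by (simp add: mult_ac)
qed simp

lemma infsum_bounded_linear:
  assumes "bounded_linear h" "f summable_on S"
  shows "(\<Sum>\<^sub>\<infinity>n\<in>S. h (f n)) = h (infsum f S)"
  using has_sum_bounded_linear[OF assms(1) has_sum_infsum[OF assms(2)]] by (rule infsumI)

text \<open>
  The Taylor coefficients of \<open>\<surd>(1 - t)\<close> at \<open>0\<close>.
\<close>

definition sqrt_coeff :: "nat \<Rightarrow> real"
  where "sqrt_coeff n = (- 1) ^ n * ((1/2) gchoose n)"

lemma sqrt_coeff_0: "sqrt_coeff 0 = 1"
  by (simp add: sqrt_coeff_def)

lemma sqrt_coeff_pochhammer: "sqrt_coeff n = pochhammer (- 1/2) n / fact n"
  by (simp add: sqrt_coeff_def gbinomial_pochhammer)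

lemma sqrt_coeff_nonpos:
  assumes "n > 0"
  shows "sqrt_coeff n \<le> 0"
proof -
  obtain m where n: "n = Suc m"
    using assms gr0_implies_Suc by blast
  have "pochhammer (1/2 :: real) m \<ge> 0"
    by (simp add: pochhammer_nonneg)
  then show ?thesis
    by (simp add: n sqrt_coeff_pochhammer pochhammer_rec divide_le_0_iff)
qed

text \<open>
  The partial sums have a closed form, because dividing \<open>\<surd>(1 - t)\<close> by \<open>1 - t\<close> gives \<open>1/\<surd>(1 - t)\<close>, all
  of whose coefficients are positive.
\<close>

lemma sum_sqrt_coeff_nonneg: "(\<Sum>k\<le>n. sqrt_coeff k) \<ge> 0"
proof -
  have "(\<Sum>k\<le>n. sqrt_coeff k) = (- 1) ^ n * ((1/2 - 1) gchoose n)"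
    using gbinomial_sum_lower_neg[of "1/2 :: real" n] by (simp add: sqrt_coeff_def mult.commute)
  also have "\<dots> = pochhammer (1/2) n / fact n"
    by (simp add: gbinomial_pochhammer)
  also have "\<dots> \<ge> 0"
    by (simp add: pochhammer_nonneg)
  finally show ?thesis .
qed

text \<open>
  Only the coefficient of index \<open>0\<close> is positive and it equals \<open>1\<close>, so the absolute values add up to
  \<open>2\<close> minus the partial sum, and the partial sums are nonnegative.
\<close>

lemma abs_summable_sqrt_coeff: "(\<lambda>n. \<bar>sqrt_coeff n\<bar>) summable_on UNIV"
proof -
  have abs_eq: "\<bar>sqrt_coeff k\<bar> = (if k = 0 then 2 else 0) - sqrt_coeff k" for k
    using sqrt_coeff_nonpos[of k] by (cases "k = 0") (simp_all add: sqrt_coeff_0)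
  have "(\<Sum>k\<le>n. \<bar>sqrt_coeff k\<bar>) \<le> 2" for n
    using sum_sqrt_coeff_nonneg[of n] by (simp add: abs_eq sum_subtractf)
  then have "summable (\<lambda>n. \<bar>sqrt_coeff n\<bar>)"
    by (intro bounded_imp_summable) auto
  then show ?thesis
    by (simp add: summable_on_UNIV_nonneg_real_iff)
qed

lemma infsum_sqrt_coeff_nonneg: "infsum sqrt_coeff UNIV \<ge> 0"
proof -
  have "sqrt_coeff summable_on UNIV"
    using abs_summable_sqrt_coeff summable_on_iff_abs_summable_on_real[of sqrt_coeff UNIV] by simp
  then have "sqrt_coeff sums infsum sqrt_coeff UNIV"
    by (intro has_sum_imp_sums has_sum_infsum)
  then show ?thesis
    unfolding sums_def_le by (rule LIMSEQ_le_const) (use sum_sqrt_coeff_nonneg in auto)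
qed

text \<open>
  The coefficients of \<open>\<surd>(1 - t) \<cdot> \<surd>(1 - t) = 1 - t\<close>, by Vandermonde's identity.
\<close>

lemma sqrt_coeff_convolution:
  "(\<Sum>k\<le>n. sqrt_coeff k * sqrt_coeff (n - k)) = (if n = 0 then 1 else if n = 1 then - 1 else 0)"
proof -
  have "(\<Sum>k\<le>n. sqrt_coeff k * sqrt_coeff (n - k)) =
      (- 1) ^ n * (\<Sum>k=0..n. ((1/2) gchoose k) * ((1/2) gchoose (n - k)))"
    unfolding sum_distrib_left atMost_atLeast0
    by (rule sum.cong) (simp_all add: sqrt_coeff_def flip: power_add)
  also have "\<dots> = (- 1) ^ n * (1 gchoose n)"
    by (simp add: gbinomial_Vandermonde)
  also have "(1::real) gchoose n = of_nat (1 choose n)"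
    using binomial_gbinomial[of 1 n, where 'a = real] by simp
  finally show ?thesis
    by (cases "n = 0"; cases "n = 1") (simp_all add: binomial_eq_0)
qed

lemma summable_sqrt_coeff_scaleR:
  fixes v :: "nat \<Rightarrow> 'b::banach"
  assumes "\<And>n. norm (v n) \<le> C"
  shows "(\<lambda>n. norm (sqrt_coeff n *\<^sub>R v n)) summable_on UNIV"
    and "(\<lambda>n. sqrt_coeff n *\<^sub>R v n) summable_on UNIV"
proof -
  show "(\<lambda>n. norm (sqrt_coeff n *\<^sub>R v n)) summable_on UNIV"
  proof (rule Infinite_Sum.abs_summable_on_comparison_test')
    show "(\<lambda>n. \<bar>sqrt_coeff n\<bar> * C) summable_on UNIV"
      using abs_summable_sqrt_coeff by (rule summable_on_cmult_left)
  qed (use assms in \<open>simp add: mult_left_mono\<close>)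
  then show "(\<lambda>n. sqrt_coeff n *\<^sub>R v n) summable_on UNIV"
    by (rule Infinite_Sum.abs_summable_summable)
qed

text \<open>
  The Cauchy product of the series with itself, for a bounded sequence \<open>v n\<close> standing for the
  orbit \<open>A\<^sup>n x\<close>. Absolute summability over all pairs permits summation along the diagonals
  \<open>n + m = k\<close>, where only \<open>k = 0\<close> and \<open>k = 1\<close> contribute.
\<close>

lemma sqrt_coeff_double_series:
  fixes v :: "nat \<Rightarrow> 'b::banach"
  assumes v: "\<And>n. norm (v n) \<le> C"
  shows "(\<Sum>\<^sub>\<infinity>n. sqrt_coeff n *\<^sub>R (\<Sum>\<^sub>\<infinity>m. sqrt_coeff m *\<^sub>R v (n + m))) = v 0 - v 1"
proof -
  let ?a = sqrt_coeff
  define g where "g = (\<lambda>(n, m). (?a n * ?a m) *\<^sub>R v (n + m))"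
  have "(\<lambda>p. norm (?a (fst p) * ?a (snd p))) summable_on UNIV \<times> UNIV"
    using abs_summable_sqrt_coeff
    by (subst Infinite_Sum.abs_summable_on_Sigma_iff)
       (auto simp: abs_mult infsum_cmult_right' abs_mult intro!: summable_on_cmult_right summable_on_cmult_left)
  then have "(\<lambda>p. norm (?a (fst p) * ?a (snd p)) * C) summable_on UNIV \<times> UNIV"
    by (rule summable_on_cmult_left)
  then have "(\<lambda>p. norm (g p)) summable_on UNIV \<times> UNIV"
    by (rule Infinite_Sum.abs_summable_on_comparison_test')
       (use v in \<open>auto simp: g_def abs_mult intro!: mult_left_mono\<close>)
  then have g: "g summable_on UNIV \<times> UNIV"
    by (rule Infinite_Sum.abs_summable_summable)
  have "(\<Sum>\<^sub>\<infinity>n. ?a n *\<^sub>R (\<Sum>\<^sub>\<infinity>m. ?a m *\<^sub>R v (n + m))) = (\<Sum>\<^sub>\<infinity>n. \<Sum>\<^sub>\<infinity>m. g (n, m))"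
    by (simp add: g_def infsum_scaleR_right flip: scaleR_scaleR)
  also have "\<dots> = infsum g (UNIV \<times> UNIV)"
    using g by (rule infsum_Sigma_banach)
  also have bij: "bij_betw (\<lambda>(k, n). (n, k - n)) (SIGMA k:UNIV. {..k}) (UNIV \<times> (UNIV :: nat set))"
    by (rule bij_betwI[where g = "\<lambda>(n, m). (n + m, n)"]) auto
  then have "infsum g (UNIV \<times> UNIV) = (\<Sum>\<^sub>\<infinity>p\<in>(SIGMA k:UNIV. {..k}). g (case p of (k, n) \<Rightarrow> (n, k - n)))"
    by (simp add: infsum_reindex_bij_betw)
  also have "\<dots> = (\<Sum>\<^sub>\<infinity>k. \<Sum>\<^sub>\<infinity>n\<in>{..k}. g (n, k - n))"
    using g by (subst infsum_Sigma_banach[symmetric]) (simp_all add: summable_on_reindex_bij_betw[OF bij])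
  also have "\<dots> = (\<Sum>\<^sub>\<infinity>k. (\<Sum>n\<le>k. ?a n * ?a (k - n)) *\<^sub>R v k)"
    by (simp add: g_def scaleR_left.sum)
  also have "\<dots> = (\<Sum>\<^sub>\<infinity>k\<in>{0, 1}. (\<Sum>n\<le>k. ?a n * ?a (k - n)) *\<^sub>R v k)"
    by (rule infsum_cong_neutral) (simp_all add: sqrt_coeff_convolution)
  also have "\<dots> = v 0 - v 1"
    by (simp add: sqrt_coeff_convolution)
  finally show ?thesis .
qed

definition sqrt_series :: "('a::banach \<Rightarrow> 'a) \<Rightarrow> 'a \<Rightarrow> 'a"
  where "sqrt_series A x = (\<Sum>\<^sub>\<infinity>n. sqrt_coeff n *\<^sub>R (A ^^ n) x)"

locale contraction =
  fixes A :: "'a::chilbert_space \<Rightarrow> 'a"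
  assumes bounded_clinear: "bounded_clinear A"
    and contractive: "norm (A x) \<le> norm x"
begin

lemma norm_power_le: "norm ((A ^^ n) x) \<le> norm x"
  using norm_funpow_le[of 1 A n x] contractive by simp

lemma bounded_clinear_power: "bounded_clinear (A ^^ n)"
proof (induction n)
  case 0
  show ?case by (simp add: bounded_clinear_def id_def)
next
  case (Suc n)
  show ?case using bounded_clinear_comp[OF bounded_clinear Suc] by (simp add: o_def)
qed

lemmas summable = summable_sqrt_coeff_scaleR[of "\<lambda>n. (A ^^ n) x" "norm x" for x, OF norm_power_le]

lemma commute_bounded_linear:
  assumes C: "bounded_linear C" and "\<And>x. C (A x) = A (C x)"
  shows "C (sqrt_series A x) = sqrt_series A (C x)"
proof -
  interpret C: bounded_linear C by fact
  have "C (sqrt_coeff n *\<^sub>R (A ^^ n) x) = sqrt_coeff n *\<^sub>R (A ^^ n) (C x)" for n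
    by (simp add: C.scaleR funpow_commute_apply[of C A, OF assms(2)])
  then show ?thesis
    unfolding sqrt_series_def
    using infsum_bounded_linear[OF C summable(2)[of x]] by (simp add: o_def)
qed

lemma bounded_clinear_sqrt_series: "bounded_clinear (sqrt_series A)"
  unfolding bounded_clinear_def
proof (intro conjI allI)
  let ?s = "\<Sum>\<^sub>\<infinity>n. \<bar>sqrt_coeff n\<bar>"
  note [simp] = linear_add[OF bounded_clinear_linear[OF bounded_clinear_power]]
  show "bounded_linear (sqrt_series A)"
  proof (rule bounded_linear_intro[where K = ?s])
    show "sqrt_series A (x + y) = sqrt_series A x + sqrt_series A y" for x y
      using infsum_add[OF summable(2)[of x] summable(2)[of y]]
      by (simp add: sqrt_series_def scaleR_add_right)
    show "sqrt_series A (r *\<^sub>R x) = r *\<^sub>R sqrt_series A x" for r x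
      by (rule commute_bounded_linear[symmetric])
         (simp_all add: bounded_linear_scaleR_right linear_scale[OF bounded_clinear_linear[OF bounded_clinear]])
    fix x
    have "norm (sqrt_series A x) \<le> (\<Sum>\<^sub>\<infinity>n. norm (sqrt_coeff n *\<^sub>R (A ^^ n) x))"
      unfolding sqrt_series_def by (rule norm_infsum_bound[OF summable(1)])
    also have "\<dots> \<le> (\<Sum>\<^sub>\<infinity>n. \<bar>sqrt_coeff n\<bar> * norm x)"
      by (intro infsum_mono summable(1) summable_on_cmult_left abs_summable_sqrt_coeff)
         (simp add: mult_left_mono norm_power_le)
    also have "\<dots> = norm x * ?s"
      by (simp only: infsum_cmult_left' mult.commute[of "norm x"])
    finally show "norm (sqrt_series A x) \<le> norm x * ?s" .
  qed
  show "sqrt_series A (a *\<^sub>C x) = a *\<^sub>C sqrt_series A x" for a x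
    by (rule commute_bounded_linear[symmetric])
       (simp_all add: bounded_linear_scaleC bounded_clinearD[OF bounded_clinear])
qed

lemma sqrt_series_square: "sqrt_series A (sqrt_series A x) = x - A x"
proof -
  have "(A ^^ n) (sqrt_series A x) = (\<Sum>\<^sub>\<infinity>m. sqrt_coeff m *\<^sub>R (A ^^ (n + m)) x)" for n
    using infsum_bounded_linear[OF bounded_clinearD(1)[OF bounded_clinear_power] summable(2), of n x]
    by (simp add: sqrt_series_def funpow_add linear_scale[OF bounded_clinear_linear[OF bounded_clinear_power]])
  then show ?thesis
    using sqrt_coeff_double_series[of "\<lambda>n. (A ^^ n) x", OF norm_power_le]
    by (simp add: sqrt_series_def[of A "sqrt_series A x"])
qed

lemma inner_sqrt_series:
  "inner (sqrt_series A x) y = (\<Sum>\<^sub>\<infinity>n. sqrt_coeff n * inner ((A ^^ n) x) y)"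
  using infsum_bounded_linear[OF bounded_linear_inner_left[of y] summable(2)[of x]]
  by (simp add: sqrt_series_def)

text \<open>
  For \<open>n > 0\<close> the coefficient is nonpositive and \<open>A\<^sup>n x \<bullet> x \<le> \<parallel>x\<parallel>\<^sup>2\<close>; hence, term by term, the series is
  at least \<open>\<parallel>x\<parallel>\<^sup>2\<close> times the sum of the coefficients.
\<close>

lemma inner_sqrt_series_nonneg: "inner (sqrt_series A x) x \<ge> 0"
proof -
  have summable': "(\<lambda>n. sqrt_coeff n * c n) summable_on UNIV" 
      if "\<And>n. \<bar>c n\<bar> \<le> d" for c d
    using summable_sqrt_coeff_scaleR(2)[of c d] that by simp
  have le: "\<bar>inner ((A ^^ n) x) x\<bar> \<le> (norm x)\<^sup>2" for n
    using Cauchy_Schwarz_ineq2[of "(A ^^ n) x" x] mult_right_mono[OF norm_power_le[of n x], of "norm x"]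
    by (simp add: power2_eq_square)
  have "0 \<le> infsum sqrt_coeff UNIV * (norm x)\<^sup>2"
    using infsum_sqrt_coeff_nonneg by simp
  also have "\<dots> = (\<Sum>\<^sub>\<infinity>n. sqrt_coeff n * (norm x)\<^sup>2)"
    by (simp add: infsum_cmult_left')
  also have "\<dots> \<le> (\<Sum>\<^sub>\<infinity>n. sqrt_coeff n * inner ((A ^^ n) x) x)"
  proof (rule infsum_mono)
    fix n
    show "sqrt_coeff n * (norm x)\<^sup>2 \<le> sqrt_coeff n * inner ((A ^^ n) x) x"
    proof (cases "n = 0")
      case False
      then show ?thesis
        using le[of n] by (intro mult_left_mono_neg sqrt_coeff_nonpos) auto
    qed (simp add: dot_square_norm)
  qed (auto intro!: summable'[where d = "(norm x)\<^sup>2"] le)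
  finally show ?thesis
    by (simp add: inner_sqrt_series)
qed

end

section \<open>Positive operators and their square roots\<close>

text \<open>
  Over the complex numbers a real quadratic form forces symmetry: polarising the condition
  \<open>T z \<bullet> \<i>z = 0\<close> at \<open>z = x + w\<close> and setting \<open>w = - \<i>y\<close> yields \<open>T x \<bullet> y = x \<bullet> T y\<close>. This makes the real
  inner product sufficient for the study of positive operators.
\<close>

lemma positive_op_iff:
  fixes T :: "'a::chilbert_space \<Rightarrow> 'a"
  shows "positive_op T \<longleftrightarrow>
    bounded_clinear T \<and> (\<forall>x y. inner (T x) y = inner x (T y)) \<and> (\<forall>x. inner (T x) x \<ge> 0)"
proof (intro iffI conjI allI; (elim conjE)?)
  assume T: "positive_op T"
  then show clin: "bounded_clinear T" and "inner (T x) x \<ge> 0" for x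
    by (auto simp: positive_op_def Re_cinner)
  note T_simps = bounded_clinearD(2)[OF clin] linear_add[OF bounded_clinear_linear[OF clin]]
  have real: "inner (T z) (\<i> *\<^sub>C z) = 0" for z
    using T complex_is_Real_iff by (auto simp: positive_op_def Im_cinner inner_ii_left)
  fix x y
  have "inner (T x) (\<i> *\<^sub>C w) = inner (\<i> *\<^sub>C T w) x" for w
    using real[of "x + w"] real[of x] real[of w]
    by (simp add: T_simps scaleC_add_right inner_add inner_ii_left)
  from this[of "- \<i> *\<^sub>C y"] show "inner (T x) y = inner x (T y)"
    by (simp add: T_simps scaleC_scaleC inner_commute)
next
  assume T: "bounded_clinear T" "\<forall>x y. inner (T x) y = inner x (T y)" "\<forall>x. inner (T x) x \<ge> 0"
  have "Im (cinner (T x) x) = 0" for x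
  proof -
    have "inner (\<i> *\<^sub>C T x) x = inner (\<i> *\<^sub>C x) (T x)"
      using T(2) by (simp flip: bounded_clinearD(2)[OF T(1)])
    then show ?thesis
      by (simp add: Im_cinner inner_ii_left[of "T x" x] inner_commute[of "\<i> *\<^sub>C x"])
  qed
  with T show "positive_op T"
    by (auto simp: positive_op_def complex_is_Real_iff Re_cinner)
qed

lemma positive_opD:
  assumes "positive_op T"
  shows "bounded_clinear T" "inner (T x) y = inner x (T y)" "inner (T x) x \<ge> 0"
  using assms by (auto simp: positive_op_iff)

text \<open>
  Since \<open>T\<close> is positive with bound \<open>K\<close>, one has \<open>\<parallel>T x\<parallel>\<^sup>2 \<le> K (T x \<bullet> x)\<close>: expand the quadratic form of \<open>T\<close> at
  \<open>x - T x / K\<close>. Expanding \<open>\<parallel>x - T x / K\<parallel>\<^sup>2\<close> and inserting this inequality gives the claim.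
\<close>

lemma positive_op_contraction:
  fixes T :: "'a::chilbert_space \<Rightarrow> 'a"
  assumes T: "positive_op T" and K: "K > 0" "\<And>x. norm (T x) \<le> K * norm x"
  shows "contraction (\<lambda>x. x - (1 / K) *\<^sub>R T x)"
proof
  note lin = bounded_clinear_linear[OF positive_opD(1)[OF T]]
  show "bounded_clinear (\<lambda>x. x - (1 / K) *\<^sub>R T x)"
    unfolding bounded_clinear_def
  proof (intro conjI allI)
    show "bounded_linear (\<lambda>x. x - (1 / K) *\<^sub>R T x)"
      by (intro bounded_linear_sub bounded_linear_ident 
          bounded_linear_compose[OF bounded_linear_scaleR_right bounded_clinearD(1)[OF positive_opD(1)[OF T]]])
    show "a *\<^sub>C x - (1 / K) *\<^sub>R T (a *\<^sub>C x) = a *\<^sub>C (x - (1 / K) *\<^sub>R T x)" for a x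
      by (simp add: bounded_clinearD(2)[OF positive_opD(1)[OF T]]
          linear_diff[OF bounded_linear.linear[OF bounded_linear_scaleC]]
          linear_scale[OF bounded_linear.linear[OF bounded_linear_scaleC]])
  qed
  fix x
  let ?y = "x - (1 / K) *\<^sub>R T x"
  have TT: "inner (T (T x)) (T x) \<le> K * (norm (T x))\<^sup>2"
    using norm_cauchy_schwarz[of "T (T x)" "T x"] mult_right_mono[OF K(2)[of "T x"], of "norm (T x)"]
    by (simp add: power2_eq_square mult_ac)
  have "0 \<le> inner (T ?y) ?y"
    by (rule positive_opD(3)[OF T])
  also have "\<dots> = inner (T x) x - 2 / K * (norm (T x))\<^sup>2 + inner (T (T x)) (T x) / K\<^sup>2"
    unfolding power2_norm_eq_inner
    by (simp add: linear_diff[OF lin] linear_scale[OF lin] inner_diff positive_opD(2)[OF T, of "T x" x]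
        power2_eq_square algebra_simps)
  also have "\<dots> \<le> inner (T x) x - 2 / K * (norm (T x))\<^sup>2 + K * (norm (T x))\<^sup>2 / K\<^sup>2"
    using TT by (simp add: divide_right_mono)
  also have "\<dots> = inner (T x) x - (norm (T x))\<^sup>2 / K"
    using K(1) by (simp add: power2_eq_square field_simps)
  finally have key: "(norm (T x))\<^sup>2 / K \<le> inner (T x) x" by simp
  have "(norm ?y)\<^sup>2 = (norm x)\<^sup>2 - (2 * inner (T x) x - (norm (T x))\<^sup>2 / K) / K"
    using K(1) unfolding power2_norm_eq_inner
    by (simp add: inner_diff inner_commute power2_eq_square field_simps)
  also have "\<dots> \<le> (norm x)\<^sup>2"
    using key positive_opD(3)[OF T, of x] K(1) by simp
  finally show "norm ?y \<le> norm x"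
    by simp
qed

text \<open>
  With \<open>A = 1 - T/K\<close> the series gives a square root of \<open>1 - A = T/K\<close>, which is then scaled by \<open>\<surd>K\<close>.
  The clause on commuting operators is what uniqueness and the main theorem rest on.
\<close>

lemma positive_sqrt_exists:
  fixes T :: "'a::chilbert_space \<Rightarrow> 'a"
  assumes T: "positive_op T"
  shows "\<exists>P. positive_op P \<and> P \<circ> P = T \<and>
    (\<forall>C. bounded_linear C \<longrightarrow> (\<forall>x. C (T x) = T (C x)) \<longrightarrow> (\<forall>x. C (P x) = P (C x)))"
proof -
  obtain K where K: "K > 0" "\<And>x. norm (T x) \<le> K * norm x"
    using bounded_clinear_bound[OF positive_opD(1)[OF T]] by blast
  define A where "A x = x - (1 / K) *\<^sub>R T x" for x
  interpret contraction A
    unfolding A_def by (rule positive_op_contraction[OF T K])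
  define P where "P x = sqrt K *\<^sub>R sqrt_series A x" for x
  note lin = bounded_clinear_linear[OF bounded_clinear_sqrt_series]
  have "bounded_clinear P"
    unfolding bounded_clinear_def
  proof (intro conjI allI)
    show "bounded_linear P"
      unfolding P_def using bounded_clinearD(1)[OF bounded_clinear_sqrt_series]
      by (rule bounded_linear_compose[OF bounded_linear_scaleR_right])
    show "P (a *\<^sub>C x) = a *\<^sub>C P x" for a x
      by (simp add: P_def bounded_clinearD(2)[OF bounded_clinear_sqrt_series]
          linear_scale[OF bounded_linear.linear[OF bounded_linear_scaleC]])
  qed
  moreover have "inner (P x) y = inner x (P y)" for x y
  proof -
    have sym: "inner (A u) v = inner u (A v)" for u v
      by (simp add: A_def inner_diff positive_opD(2)[OF T])
    have "inner ((A ^^ n) u) v = inner u ((A ^^ n) v)" for n u v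
      by (induction n arbitrary: u v) (simp_all add: sym funpow_swap1)
    then show ?thesis
      by (simp add: P_def inner_sqrt_series inner_commute[of x])
  qed
  moreover have "inner (P x) x \<ge> 0" for x
    using K(1) inner_sqrt_series_nonneg[of x] by (simp add: P_def)
  ultimately have "positive_op P"
    by (simp add: positive_op_iff)
  moreover have "P (P x) = T x" for x
    using K(1) by (simp add: P_def linear_scale[OF lin] sqrt_series_square A_def)
  moreover have "C (P x) = P (C x)" if C: "bounded_linear C" "\<And>x. C (T x) = T (C x)" for C x
  proof -
    interpret C: bounded_linear C by (rule C(1))
    have "C (A x) = A (C x)" for x
      by (simp add: A_def C.diff C.scaleR C(2))
    from commute_bounded_linear[OF C(1) this] show ?thesis
      by (simp add: P_def C.scaleR)
  qed
  ultimately show ?thesis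
    by (intro exI[of _ P]) auto
qed

text \<open>
  If \<open>R\<close> is a positive square root of \<open>T\<close>, the form \<open>T x \<bullet> x\<close> is \<open>\<parallel>R x\<parallel>\<^sup>2\<close>.
\<close>

lemma positive_op_kernel:
  assumes T: "positive_op T" and 0: "inner (T x) x = 0"
  shows "T x = 0"
proof -
  obtain R where R: "positive_op R" "R \<circ> R = T"
    using positive_sqrt_exists[OF T] by blast
  have T_eq: "T x = R (R x)"
    using R(2) by (metis comp_apply)
  then have "inner (R x) (R x) = 0"
    using 0 by (simp add: positive_opD(2)[OF R(1), of "R x"])
  then show ?thesis
    using T_eq linear_0[OF bounded_clinear_linear[OF positive_opD(1)[OF R(1)]]] by simp
qed

text \<open>
  For \<open>y = P x - Q x\<close> one gets \<open>(P + Q) y = (P\<^sup>2 - Q\<^sup>2) x = 0\<close>. So the nonnegative forms of \<open>P\<close> and \<open>Q\<close>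
  vanish at \<open>y\<close>, whence \<open>P y = Q y = 0\<close> and \<open>\<parallel>y\<parallel>\<^sup>2 = x \<bullet> (P - Q) y = 0\<close>.
\<close>

lemma positive_sqrt_unique:
  fixes P Q :: "'a::chilbert_space \<Rightarrow> 'a"
  assumes P: "positive_op P" and Q: "positive_op Q" and eq: "P \<circ> P = Q \<circ> Q"
    and comm: "\<And>x. P (Q x) = Q (P x)"
  shows "P = Q"
proof
  fix x
  note diff = linear_diff[OF bounded_clinear_linear[OF positive_opD(1)[OF P]]]
    linear_diff[OF bounded_clinear_linear[OF positive_opD(1)[OF Q]]]
  define y where "y = P x - Q x"
  have "P y + Q y = 0"
    using fun_cong[OF eq, of x] by (simp add: y_def diff comm)
  then have "inner (P y) y + inner (Q y) y = 0"
    by (metis inner_add_left inner_zero_left)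
  then have "inner (P y) y = 0" "inner (Q y) y = 0"
    using positive_opD(3)[OF P, of y] positive_opD(3)[OF Q, of y] by linarith+
  then have "P y = 0" "Q y = 0"
    using positive_op_kernel P Q by blast+
  then have "inner (P x) y = 0" "inner (Q x) y = 0"
    using positive_opD(2)[OF P, of x y] positive_opD(2)[OF Q, of x y] by simp_all
  moreover have "inner y y = inner (P x) y - inner (Q x) y"
    by (simp add: y_def inner_diff_left)
  ultimately have "inner y y = 0" by simp
  then show "P x = Q x"
    by (simp add: y_def)
qed

text \<open>
  Any positive root \<open>S\<close> of \<open>T\<close> commutes with \<open>T = S\<^sup>2\<close>, hence with the root given by the series, so it
  coincides with that root.
\<close>

lemma sqrt_op_eqI:
  fixes T :: "'a::chilbert_space \<Rightarrow> 'a"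
  assumes Q: "positive_op Q" "Q \<circ> Q = T"
  shows "sqrt_op T = Q"
proof -
  have "inner (Q (Q x)) x \<ge> 0" for x
    by (simp add: positive_opD(2)[OF Q(1), of "Q x" x])
  moreover have "inner (Q (Q x)) y = inner x (Q (Q y))" for x y
    by (simp add: positive_opD(2)[OF Q(1)])
  ultimately have T: "positive_op T"
    using bounded_clinear_comp[OF positive_opD(1)[OF Q(1)] positive_opD(1)[OF Q(1)]] Q(2)
    by (auto simp: positive_op_iff)
  obtain P where P: "positive_op P" "P \<circ> P = T"
    and comm: "\<And>C x. bounded_linear C \<Longrightarrow> (\<And>x. C (T x) = T (C x)) \<Longrightarrow> C (P x) = P (C x)"
    using positive_sqrt_exists[OF T] by blast
  have eq_P: "S = P" if S: "positive_op S" "S \<circ> S = T" for S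
  proof (rule positive_sqrt_unique[OF S(1) P(1)])
    show "S (P x) = P (S x)" for x
      using bounded_clinearD(1)[OF positive_opD(1)[OF S(1)]] by (rule comm) (simp flip: S(2))
  qed (simp add: S P)
  show ?thesis
    unfolding sqrt_op_def by (rule the_equality) (use Q eq_P in auto)
qed

lemma sqrt_op:
  fixes T :: "'a::chilbert_space \<Rightarrow> 'a"
  assumes T: "positive_op T"
  shows positive_op_sqrt_op: "positive_op (sqrt_op T)"
    and sqrt_op_square: "sqrt_op T \<circ> sqrt_op T = T"
    and sqrt_op_commute:
      "bounded_linear C \<Longrightarrow> C \<circ> T = T \<circ> C \<Longrightarrow> C \<circ> sqrt_op T = sqrt_op T \<circ> C"
proof -
  obtain P where P: "positive_op P" "P \<circ> P = T"
    and comm: "\<And>C x. bounded_linear C \<Longrightarrow> (\<And>x. C (T x) = T (C x)) \<Longrightarrow> C (P x) = P (C x)"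
    using positive_sqrt_exists[OF T] by blast
  have eq: "sqrt_op T = P"
    by (rule sqrt_op_eqI[OF P])
  show "positive_op (sqrt_op T)" "sqrt_op T \<circ> sqrt_op T = T"
    using P by (simp_all only: eq)
  show "C \<circ> sqrt_op T = sqrt_op T \<circ> C" if "bounded_linear C" "C \<circ> T = T \<circ> C"
    using comm[OF that(1)] that(2) by (simp add: eq fun_eq_iff)
qed

text \<open>
  If \<open>R\<close> is the root of \<open>P\<close>, it commutes with \<open>Q\<close>, and so \<open>P Q x \<bullet> x = Q (R x) \<bullet> R x\<close>.
\<close>

lemma positive_op_comp:
  fixes P Q :: "'a::chilbert_space \<Rightarrow> 'a"
  assumes P: "positive_op P" and Q: "positive_op Q" and comm: "P \<circ> Q = Q \<circ> P"
  shows "positive_op (P \<circ> Q)"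
  unfolding positive_op_iff
proof (intro conjI allI)
  show "bounded_clinear (P \<circ> Q)"
    using P Q by (intro bounded_clinear_comp positive_opD)
  show "inner ((P \<circ> Q) x) y = inner x ((P \<circ> Q) y)" for x y
    using fun_cong[OF comm, of y] by (simp add: positive_opD(2)[OF P] positive_opD(2)[OF Q])
  fix x
  let ?R = "sqrt_op P"
  have R: "?R (Q z) = Q (?R z)" for z
    using fun_cong[OF sqrt_op_commute[OF P bounded_clinearD(1)[OF positive_opD(1)[OF Q]]], of z] comm
    by simp
  have "inner ((P \<circ> Q) x) x = inner (?R (?R (Q x))) x"
    using fun_cong[OF sqrt_op_square[OF P], of "Q x"] by simp
  also have "\<dots> = inner (Q (?R x)) (?R x)"
    by (simp only: R[symmetric] positive_opD(2)[OF positive_op_sqrt_op[OF P], of "?R (Q x)"])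
  finally show "inner ((P \<circ> Q) x) x \<ge> 0"
    using positive_opD(3)[OF Q] by simp
qed

lemma positive_op_cadjoint_comp:
  fixes T :: "'a::chilbert_space \<Rightarrow> 'a"
  assumes T: "bounded_clinear T"
  shows "positive_op (cadjoint T \<circ> T)"
proof -
  have adj: "inner (T x) y = inner x (cadjoint T y)" for x y
    by (simp flip: Re_cinner add: cinner_cadjoint[OF T])
  then show ?thesis
    using bounded_clinear_comp[OF bounded_clinear_cadjoint[OF T] T]
    by (simp add: positive_op_iff inner_commute[of "cadjoint T z" for z] flip: adj)
       (simp add: inner_commute)
qed

section \<open>Fuglede's theorem\<close>

text \<open>
  A vector-valued polynomial in a complex variable, of which only the coefficients of degree \<open>0\<close> and
  \<open>1\<close> are recorded. Requiring \<open>c\<close> to vanish above the degree bound \<open>d\<close> makes \<open>c\<^sub>1\<close> the linear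
  coefficient also when \<open>d = 0\<close>.
\<close>

definition poly_curve :: "(complex \<Rightarrow> 'a::complex_inner) \<Rightarrow> 'a \<Rightarrow> 'a \<Rightarrow> bool"
  where "poly_curve v c\<^sub>0 c\<^sub>1 \<longleftrightarrow>
    (\<exists>d c. c 0 = c\<^sub>0 \<and> c (Suc 0) = c\<^sub>1 \<and> (\<forall>k>d. c k = 0) \<and> (\<forall>z. v z = (\<Sum>k\<le>d. z ^ k *\<^sub>C c k)))"

lemma poly_curve_const: "poly_curve (\<lambda>_. y) y 0"
  unfolding poly_curve_def
  by (rule exI[of _ 0], rule exI[of _ "\<lambda>k. if k = 0 then y else 0"]) simp

lemma poly_curve_map:
  assumes v: "poly_curve v c\<^sub>0 c\<^sub>1" and B: "bounded_clinear B"
  shows "poly_curve (\<lambda>z. B (v z)) (B c\<^sub>0) (B c\<^sub>1)"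
proof -
  obtain d c where c: "c 0 = c\<^sub>0" "c (Suc 0) = c\<^sub>1" "\<forall>k>d. c k = 0" "\<And>z. v z = (\<Sum>k\<le>d. z ^ k *\<^sub>C c k)"
    using v unfolding poly_curve_def by blast
  note lin = bounded_clinear_linear[OF B]
  show ?thesis
    unfolding poly_curve_def
    by (rule exI[of _ d], rule exI[of _ "\<lambda>k. B (c k)"])
       (simp add: c linear_0[OF lin] linear_sum[OF lin] bounded_clinearD(2)[OF B])
qed

lemma poly_curve_step:
  assumes v: "poly_curve v c\<^sub>0 c\<^sub>1" and T: "bounded_clinear T"
  shows "poly_curve (\<lambda>z. v z + (z * s) *\<^sub>C T (v z)) c\<^sub>0 (c\<^sub>1 + s *\<^sub>C T c\<^sub>0)"
proof -
  obtain d c where c: "c 0 = c\<^sub>0" "c (Suc 0) = c\<^sub>1" "\<forall>k>d. c k = 0" "\<And>z. v z = (\<Sum>k\<le>d. z ^ k *\<^sub>C c k)"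
    using v unfolding poly_curve_def by blast
  note lin = bounded_clinear_linear[OF T]
  define e where "e k = c k + (case k of 0 \<Rightarrow> 0 | Suc j \<Rightarrow> s *\<^sub>C T (c j))" for k
  have "v z + (z * s) *\<^sub>C T (v z) = (\<Sum>k\<le>Suc d. z ^ k *\<^sub>C e k)" for z
  proof -
    have "(\<Sum>k\<le>Suc d. z ^ k *\<^sub>C e k) = 
       (\<Sum>k\<le>Suc d. z ^ k *\<^sub>C c k) + (\<Sum>k\<le>Suc d. z ^ k *\<^sub>C (case k of 0 \<Rightarrow> 0 | Suc j \<Rightarrow> s *\<^sub>C T (c j)))"
      by (simp only: e_def scaleC_add_right sum.distrib)
    also have "(\<Sum>k\<le>Suc d. z ^ k *\<^sub>C c k) = v z"
      by (simp add: c(3,4))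
    also have "(\<Sum>k\<le>Suc d. z ^ k *\<^sub>C (case k of 0 \<Rightarrow> 0 | Suc j \<Rightarrow> s *\<^sub>C T (c j))) =
        (\<Sum>k\<le>d. (z * s) *\<^sub>C z ^ k *\<^sub>C T (c k))"
      by (simp only: sum.atMost_Suc_shift) (simp add: scaleC_scaleC mult_ac)
    also have "\<dots> = (z * s) *\<^sub>C T (v z)"
      by (simp add: c(4) linear_sum[OF lin] bounded_clinearD(2)[OF T]
          linear_sum[OF bounded_linear.linear[OF bounded_linear_scaleC]])
    finally show ?thesis by simp
  qed
  moreover have "\<forall>k>Suc d. e k = 0"
    using c(3) by (auto simp: e_def linear_0[OF lin] split: nat.split)
  ultimately show ?thesis
    unfolding poly_curve_def
    by (intro exI[of _ "Suc d"] exI[of _ e]) (auto simp: e_def c(1,2))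
qed

lemma poly_curve_funpow:
  assumes v: "poly_curve v c\<^sub>0 c\<^sub>1" and T: "bounded_clinear T"
  shows "poly_curve (\<lambda>z. ((\<lambda>x. x + (z * s) *\<^sub>C T x) ^^ n) (v z)) c\<^sub>0 (c\<^sub>1 + (of_nat n * s) *\<^sub>C T c\<^sub>0)"
proof (induction n)
  case (Suc n)
  show ?case
    using poly_curve_step[OF Suc T, of s] by (simp add: scaleC_add_left algebra_simps)
qed (use v in simp)

text \<open>
  Pairing the curve with \<open>c\<^sub>1\<close> itself gives a scalar polynomial with derivative \<open>\<parallel>c\<^sub>1\<parallel>\<^sup>2\<close> at \<open>0\<close> and bound
  \<open>K \<parallel>c\<^sub>1\<parallel>\<close> on the circle of radius \<open>R\<close>.
\<close>

lemma poly_curve_Cauchy_estimate: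
  fixes v :: "complex \<Rightarrow> 'a::complex_inner"
  assumes v: "poly_curve v c\<^sub>0 c\<^sub>1" and R: "R > 0" and bound: "\<And>z. cmod z = R \<Longrightarrow> norm (v z) \<le> K"
  shows "norm c\<^sub>1 \<le> K / R"
proof -
  obtain d c where c: "c 0 = c\<^sub>0" "c (Suc 0) = c\<^sub>1" "\<forall>k>d. c k = 0" "\<And>z. v z = (\<Sum>k\<le>d. z ^ k *\<^sub>C c k)"
    using v unfolding poly_curve_def by blast
  define g where "g z = cinner (v z) c\<^sub>1" for z
  define p where "p = (\<Sum>k\<le>d. monom (cinner (c k) c\<^sub>1) k)"
  have cinner_sum: "cinner (sum f S) z = (\<Sum>k\<in>S. cinner (f k) z)" for f :: "nat \<Rightarrow> 'a" and S z
    by (induction S rule: infinite_finite_induct) (simp_all add: cinner_add_left)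
  have g: "g = poly p"
    by (simp add: g_def p_def fun_eq_iff c(4) cinner_sum cinner_scaleC_left poly_sum poly_monom mult.commute)
  have "coeff p 1 = cinner c\<^sub>1 c\<^sub>1"
    using c(2) c(3)[rule_format, of "Suc 0"] by (cases "Suc 0 \<le> d") (simp_all add: p_def coeff_sum)
  then have deriv: "deriv g 0 = of_real ((norm c\<^sub>1)\<^sup>2)"
    by (simp add: g DERIV_imp_deriv[OF poly_DERIV] poly_0_coeff_0 coeff_pderiv cinner_self)
  have "norm ((deriv ^^ 1) g 0) \<le> fact 1 * (K * norm c\<^sub>1) / R ^ 1"
  proof (rule Cauchy_inequality)
    show "g holomorphic_on ball 0 R" "continuous_on (cball 0 R) g"
      unfolding g by (intro holomorphic_intros continuous_intros)+
    fix z :: complex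
    assume "cmod (0 - z) = R"
    then have "norm (v z) \<le> K"
      using bound by simp
    then show "norm (g z) \<le> K * norm c\<^sub>1"
      using cinner_Cauchy_Schwarz[of "v z" c\<^sub>1] mult_right_mono[of "norm (v z)" K "norm c\<^sub>1"]
      by (simp add: g_def)
  qed (rule R)
  then have "norm c\<^sub>1 * norm c\<^sub>1 \<le> (K / R) * norm c\<^sub>1"
    by (simp add: deriv norm_mult power2_eq_square)
  moreover have "0 \<le> K / R"
    using order_trans[OF norm_ge_zero bound[of "of_real R"]] R by simp
  ultimately show ?thesis
    by (cases "c\<^sub>1 = 0") (simp_all only: norm_zero mult_le_cancel_right, auto)
qed

text \<open>
  \<open>N\<close> and \<open>M\<close> are adjoint to each other and commute. The case \<open>n = 1\<close> is
  \<open>\<parallel>M x\<parallel>\<^sup>2 = N M x \<bullet> x = M N x \<bullet> x = \<parallel>N x\<parallel>\<^sup>2\<close>, and powers follow as \<open>N\<close> passes through those of \<open>M\<close>.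
\<close>

lemma normal_pair_funpow_norm:
  fixes N M :: "'a::complex_inner \<Rightarrow> 'a"
  assumes adj: "\<And>x y. cinner (N x) y = cinner x (M y)" and comm: "\<And>x. N (M x) = M (N x)"
  shows "norm ((M ^^ n) x) = norm ((N ^^ n) x)"
proof -
  have norm_M: "norm (M x) = norm (N x)" for x
  proof -
    have "inner (N u) v = inner u (M v)" for u v
      by (simp add: adj flip: Re_cinner)
    from this[of "M x" x] this[of x "N x"] have "inner (M x) (M x) = inner (N x) (N x)"
      by (simp add: comm inner_commute)
    then show ?thesis by (simp add: norm_eq)
  qed
  show ?thesis
  proof (induction n arbitrary: x)
    case (Suc n)
    have "norm ((M ^^ Suc n) x) = norm ((M ^^ n) (N x))"
      by (simp add: norm_M funpow_commute_apply[of N M, OF comm])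
    also have "\<dots> = norm ((N ^^ Suc n) x)"
      by (simp add: Suc funpow_swap1)
    finally show ?case .
  qed simp
qed

text \<open>
  The linear coefficient \<open>c\<close> of the polynomial curve \<open>M\<^sub>\<mu>\<^sup>n B M\<^sub>-\<^sub>\<mu>\<^sup>n y\<close>, with \<open>\<mu> = z / n\<close>, is the value of the
  commutator of \<open>A*\<close> and \<open>B\<close> at \<open>y\<close>. The curve stays bounded on circles of radius
  of order \<open>\<surd>n\<close> for two reasons: \<open>M\<^sub>\<mu>\<^sup>n\<close> may be exchanged for a power of its adjoint, which commutes
  with \<open>B\<close>, and \<open>M\<^sub>\<mu> M\<^sub>-\<^sub>\<mu> = 1 - \<mu>\<^sup>2 A*\<^sup>2\<close> differs from the identity only in second order.
\<close>

theorem fuglede: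
  fixes A B :: "'a::chilbert_space \<Rightarrow> 'a"
  assumes A: "bounded_clinear A" and B: "bounded_clinear B"
    and comm: "A \<circ> B = B \<circ> A" and normal: "normal_op A"
  shows "cadjoint A \<circ> B = B \<circ> cadjoint A"
proof
  fix y
  define S where "S = cadjoint A"
  have S: "bounded_clinear S" and adj: "cinner (A x) y = cinner x (S y)" for x y
    using cadjoint[OF A] by (simp_all add: S_def)
  note A_simps = bounded_clinearD(2)[OF A] linear_add[OF bounded_clinear_linear[OF A]]
  note S_simps = bounded_clinearD(2)[OF S] linear_add[OF bounded_clinear_linear[OF S]]
    linear_diff[OF bounded_clinear_linear[OF S]]
  note B_simps = bounded_clinearD(2)[OF B] linear_add[OF bounded_clinear_linear[OF B]]
  have AS: "A (S x) = S (A x)" for x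
    using fun_cong[OF normal[unfolded normal_op_def], of x] by (simp add: S_def)
  have AB: "A (B x) = B (A x)" for x
    using fun_cong[OF comm, of x] by simp
  obtain a where a: "a > 0" "\<And>x. norm (S x) \<le> a * norm x"
    using bounded_clinear_bound[OF S] by blast
  obtain b where b: "b > 0" "\<And>x. norm (B x) \<le> b * norm x"
    using bounded_clinear_bound[OF B] by blast
  define M where "M \<mu> = (\<lambda>x. x + \<mu> *\<^sub>C S x)" for \<mu>
  have contract: "norm ((M \<mu> ^^ n) (B x)) \<le> b * norm ((M \<mu> ^^ n) x)" for \<mu> n x
  proof -
    define N where "N x = x + cnj \<mu> *\<^sub>C A x" for x
    have norm_eq: "norm ((M \<mu> ^^ n) z) = norm ((N ^^ n) z)" for z
    proof (rule normal_pair_funpow_norm)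
      show "cinner (N x) y = cinner x (M \<mu> y)" for x y
        by (simp add: N_def M_def cinner_add_left cinner_add_right cinner_scaleC_left
            cinner_scaleC_right adj)
      show "N (M \<mu> x) = M \<mu> (N x)" for x
        by (simp add: N_def M_def A_simps S_simps AS scaleC_add_right scaleC_scaleC mult.commute)
    qed
    have "B (N x) = N (B x)" for x
      by (simp add: N_def B_simps AB)
    then have "(N ^^ n) (B x) = B ((N ^^ n) x)"
      by (simp add: funpow_commute_apply[of B N])
    then show ?thesis
      using b(2) by (simp add: norm_eq)
  qed
  have bound: "norm ((M \<mu> ^^ n) (B ((M (- \<mu>) ^^ n) y))) \<le> b * ((1 + (cmod \<mu> * a)\<^sup>2) ^ n * norm y)"
    for \<mu> n
  proof -
    have MM: "M \<mu> (M (- \<mu>) z) = z - (\<mu> * \<mu>) *\<^sub>C S (S z)" for z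
      by (simp add: M_def S_simps scaleC_add_right scaleC_diff_right scaleC_scaleC scaleC_minus_left)
    have comm_M: "M \<mu> (M (- \<mu>) z) = M (- \<mu>) (M \<mu> z)" for z
      by (simp add: M_def S_simps scaleC_add_right scaleC_diff_right scaleC_scaleC scaleC_minus_left)
    have "norm (M \<mu> (M (- \<mu>) z)) \<le> (1 + (cmod \<mu> * a)\<^sup>2) * norm z" for z
    proof -
      have "norm (S (S z)) \<le> a * (a * norm z)"
        using a(2)[of "S z"] mult_left_mono[OF a(2)[of z], of a] a(1) by linarith
      then have "cmod (\<mu> * \<mu>) * norm (S (S z)) \<le> cmod (\<mu> * \<mu>) * (a * (a * norm z))"
        by (rule mult_left_mono) simp
      then show ?thesis
        using norm_triangle_ineq4[of z "(\<mu> * \<mu>) *\<^sub>C S (S z)"]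
        by (simp add: MM norm_scaleC norm_mult power2_eq_square algebra_simps)
    qed
    then have "norm (((\<lambda>z. M \<mu> (M (- \<mu>) z)) ^^ n) y) \<le> (1 + (cmod \<mu> * a)\<^sup>2) ^ n * norm y"
      by (intro norm_funpow_le) simp_all
    moreover have "(M \<mu> ^^ n) ((M (- \<mu>) ^^ n) z) = ((\<lambda>z. M \<mu> (M (- \<mu>) z)) ^^ n) z" for z
      by (rule funpow_mult_commute) (rule comm_M)
    ultimately show ?thesis
      using order_trans[OF contract[of n \<mu> "(M (- \<mu>) ^^ n) y"]] b(1) by (simp add: mult_left_mono)
  qed
  define c where "c = S (B y) - B (S y)"
  have estimate: "norm c * real m \<le> b * (exp (a\<^sup>2) * norm y)" if "m > 0" for m :: nat
  proof -
    \<comment> \<open>On the circle of radius \<open>m\<close> the choice \<open>n = m\<^sup>2\<close> turns the factor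
      \<open>(1 + (m a / n)\<^sup>2)\<^sup>n\<close> into \<open>(1 + a\<^sup>2 / n)\<^sup>n \<le> exp (a\<^sup>2)\<close>.\<close>
    define n where "n = m\<^sup>2"
    have n: "n > 0" using that by (simp add: n_def)
    define s :: complex where "s = 1 / of_nat n"
    have "poly_curve (\<lambda>z. (M (z * - s) ^^ n) y) y (0 + (of_nat n * - s) *\<^sub>C S y)"
      unfolding M_def by (rule poly_curve_funpow[OF poly_curve_const S])
    from poly_curve_funpow[OF poly_curve_map[OF this B] S, of n s]
    have "poly_curve (\<lambda>z. (M (z * s) ^^ n) (B ((M (- (z * s)) ^^ n) y))) (B y) c"
      using n by (simp add: M_def s_def c_def B_simps scaleC_minus_left linear_neg[OF bounded_clinear_linear[OF B]])
    then have "norm c \<le> (b * (exp (a\<^sup>2) * norm y)) / real m"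
    proof (rule poly_curve_Cauchy_estimate)
      fix z :: complex
      assume z: "cmod z = real m"
      have eq: "(cmod (z * s) * a)\<^sup>2 = a\<^sup>2 / real n"
        using that by (simp add: z norm_mult norm_divide s_def n_def power2_eq_square)
      have "- real n \<le> a\<^sup>2"
        by (rule order_trans[of _ 0]) simp_all
      from exp_ge_one_plus_x_over_n_power_n[OF this n]
      have "(1 + (cmod (z * s) * a)\<^sup>2) ^ n \<le> exp (a\<^sup>2)"
        by (simp only: eq)
      then have "b * ((1 + (cmod (z * s) * a)\<^sup>2) ^ n * norm y) \<le> b * (exp (a\<^sup>2) * norm y)"
        using b(1) by (intro mult_left_mono mult_right_mono) auto
      with bound[of n "z * s"]
      show "norm ((M (z * s) ^^ n) (B ((M (- (z * s)) ^^ n) y))) \<le> b * (exp (a\<^sup>2) * norm y)"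
        by linarith
    qed (use that in simp)
    then show ?thesis
      using that by (simp add: field_simps)
  qed
  have "norm c = 0"
  proof (rule ccontr)
    assume "norm c \<noteq> 0"
    then have "norm c > 0" by simp
    then obtain m where less: "b * (exp (a\<^sup>2) * norm y) < real m * norm c"
      using reals_Archimedean3 by blast
    have "0 \<le> b * (exp (a\<^sup>2) * norm y)"
      using b(1) by simp
    with less have "m > 0"
      by (cases "m = 0") simp_all
    then show False
      using estimate[of m] less by (simp add: mult.commute)
  qed
  then show "(cadjoint A \<circ> B) y = (B \<circ> cadjoint A) y"
    by (simp add: c_def S_def)
qed

section \<open>The absolute value of a product\<close>

theorem theorem2p4:
  fixes A B :: "'a::chilbert_space \<Rightarrow> 'a"
  assumes "bounded_clinear A" and "bounded_clinear B"
    and "A \<circ> B = B \<circ> A"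
    and "normal_op A"
  shows "abs_op (A \<circ> B) = abs_op A \<circ> abs_op B"
proof -
  note A = assms(1) and B = assms(2) and AB = assms(3)
  let ?S = "cadjoint A" and ?T = "cadjoint B"
  let ?P = "abs_op A" and ?Q = "abs_op B"
  note S = bounded_clinear_cadjoint[OF A] and T = bounded_clinear_cadjoint[OF B]
  have SB: "?S \<circ> B = B \<circ> ?S"
    by (rule fuglede[OF A B AB assms(4)])
  have TS: "?T \<circ> ?S = ?S \<circ> ?T"
    using arg_cong[OF AB, of cadjoint] by (simp only: cadjoint_comp A B)
  have AT: "A \<circ> ?T = ?T \<circ> A"
    using arg_cong[OF SB, of cadjoint] by (simp only: cadjoint_comp cadjoint_cadjoint A B S)
  have ev: "B (?S x) = ?S (B x)" "?T (?S x) = ?S (?T x)" "A (?T x) = ?T (A x)" "A (B x) = B (A x)" for x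
    using SB TS AT AB by (simp_all add: fun_eq_iff)
  note AA = positive_op_cadjoint_comp[OF A] and BB = positive_op_cadjoint_comp[OF B]
  have P: "positive_op ?P" "?P \<circ> ?P = ?S \<circ> A" and Q: "positive_op ?Q" "?Q \<circ> ?Q = ?T \<circ> B"
    unfolding abs_op_def by (intro positive_op_sqrt_op sqrt_op_square AA BB)+
  have "B \<circ> ?P = ?P \<circ> B" "?T \<circ> ?P = ?P \<circ> ?T"
    unfolding abs_op_def
    by (intro sqrt_op_commute AA bounded_clinearD(1) B T; simp add: fun_eq_iff ev)+
  then have "?P \<circ> (?T \<circ> B) = (?T \<circ> B) \<circ> ?P"
    by (simp add: fun_eq_iff)
  then have PQ: "?P \<circ> ?Q = ?Q \<circ> ?P"
    unfolding abs_op_def[of B]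
    by (intro sqrt_op_commute BB bounded_clinearD(1) positive_opD(1)[OF P(1)])
  have "(?P \<circ> ?Q) \<circ> (?P \<circ> ?Q) = (?P \<circ> ?P) \<circ> (?Q \<circ> ?Q)"
    using PQ by (simp add: fun_eq_iff)
  also have "\<dots> = cadjoint (A \<circ> B) \<circ> (A \<circ> B)"
    by (simp add: P(2) Q(2) cadjoint_comp[OF A B] fun_eq_iff ev)
  finally show ?thesis
    unfolding abs_op_def[of "A \<circ> B"]
    by (rule sqrt_op_eqI[OF positive_op_comp[OF P(1) Q(1) PQ]])
qed

end
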